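(* Let $A\in\mathbb{R}^{m\times n}$, $\Lambda\in\mathbb{R}^{r\times n}$, $b\in\mathbb{R}^m$, $p\in(0,1]$, $\beta>0$, and assume $\operatorname{Ker}(A)\cap\operatorname{Ker}(\Lambda)=\{0\}$. Let $\varepsilon>0$ and let $\{x^k\}_{k\ge 0}\subset\mathbb{R}^n$ be generated, from an initial point $x^0\in\mathbb{R}^n$, by the iteration $$A^*Ax^{k+1}+\Lambda^*N(\Lambda x^k)\,\Lambda x^{k+1}=A^*b .$$ Then $J_\varepsilon(x^k)$ is strictly monotonically decreasing in $k$, unless there exists some $k$ such that $x^k=x^{k+1}$ and $x^k$ satisfies the equation $$A^*Ax+\Lambda^*N(\Lambda x)\,\Lambda x=A^*b. \qquad (\star)$$ Moreover, the sequence $\{x^k\}$ has at least one cluster point, and every cluster point of $\{x^k\}$ is a solution of $(\star)$.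
   Context: For $y\in\mathbb{R}^r$, $N(y)\in\mathbb{R}^{r\times r}$ denotes the diagonal matrix with diagonal entries $$N(y)_{ii}=\frac{\beta p}{\max(\varepsilon^{2-p},|y_i|^{2-p})}.$$ The functional $J_\varepsilon:\mathbb{R}^n\to\mathbb{R}$ is $$J_\varepsilon(x)=\tfrac12|Ax-b|_2^2+\beta\sum_{i=1}^{r}\Psi_\varepsilon\big(|(\Lambda x)_i|^2\big),$$ where for $t\ge0$ $$\Psi_\varepsilon(t)=\begin{cases}\dfrac p2\,\dfrac{t}{\varepsilon^{2-p}}+\Big(1-\dfrac p2\Big)\varepsilon^p, & 0\le t\le\varepsilon^2,\\[2mm] t^{p/2}, & t\ge\varepsilon^2.\end{cases}$$ Here $A^*,\Lambda^*$ are transposes and $|\cdot|_2$ is the Euclidean norm. Equation $(\star)$ is the necessary optimality condition for minimizing $J_\varepsilon$. *)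

theory Defs
  imports "HOL-Analysis.Analysis"
begin

definition weight_matrix :: "real \<Rightarrow> real \<Rightarrow> real \<Rightarrow> real ^ 'r \<Rightarrow> real ^ 'r ^ 'r" where
  "weight_matrix \<beta> p \<epsilon> y =
     (\<chi> i j. if i = j then \<beta> * p / max (\<epsilon> powr (2 - p)) (\<bar>y $ i\<bar> powr (2 - p)) else 0)"

text \<open>Only used for \<open>t \<ge> 0\<close>. The two branches agree at \<open>t = \<epsilon>\<^sup>2\<close>.\<close>
definition Psi :: "real \<Rightarrow> real \<Rightarrow> real \<Rightarrow> real" where
  "Psi p \<epsilon> t =
     (if t \<le> \<epsilon>\<^sup>2 then p / 2 * (t / \<epsilon> powr (2 - p)) + (1 - p / 2) * \<epsilon> powr p
      else t powr (p / 2))"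

definition J ::
  "real ^ 'n ^ 'm \<Rightarrow> real ^ 'n ^ 'r \<Rightarrow> real ^ 'm \<Rightarrow> real \<Rightarrow> real \<Rightarrow> real \<Rightarrow> real ^ 'n \<Rightarrow> real" where
  "J A \<Lambda> b \<beta> p \<epsilon> x =
     1 / 2 * (norm (A *v x - b))\<^sup>2 + \<beta> * (\<Sum>i\<in>UNIV. Psi p \<epsilon> (\<bar>(\<Lambda> *v x) $ i\<bar>\<^sup>2))"

definition optimality_eq ::
  "real ^ 'n ^ 'm \<Rightarrow> real ^ 'n ^ 'r \<Rightarrow> real ^ 'm \<Rightarrow> real \<Rightarrow> real \<Rightarrow> real \<Rightarrow> real ^ 'n \<Rightarrow> bool" where
  "optimality_eq A \<Lambda> b \<beta> p \<epsilon> x \<longleftrightarrow>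
     transpose A *v (A *v x)
       + transpose \<Lambda> *v (weight_matrix \<beta> p \<epsilon> (\<Lambda> *v x) *v (\<Lambda> *v x))
     = transpose A *v b"

definition cluster_point :: "(nat \<Rightarrow> 'a::topological_space) \<Rightarrow> 'a \<Rightarrow> bool" where
  "cluster_point x l \<longleftrightarrow> (\<exists>s. strict_mono s \<and> (x \<circ> s) \<longlonglongrightarrow> l)"

end

(* For fixed s, Psi p eps s is the minimum over M >= eps of
   p/2 * s / M^(2-p) + (1 - p/2) * M^p, by concavity of t^(p/2). When s = v^2 the minimum
   is attained at M = max eps |v|, and freezing that M gives a quadratic function of v
   touching Psi from above. The iteration minimises the resulting quadratic majorant of J,
   so with d = x (k+1) - x k a step lowers J by at least
   1/2 |A d|^2 + 1/2 sum_i w_i (Lambda d)_i^2, where w_i > 0 is the diagonal of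
   N(Lambda x k). By the kernel condition this vanishes only for d = 0, and sublevel sets
   of J are bounded. As J converges along the sequence, A d and Lambda d tend to 0 along
   any convergent subsequence, and the iteration equation passes to the limit. *)
theory Submission
  imports Defs
begin

section \<open>Quadratic majorants of \<open>Psi\<close>\<close>

lemma powr_le_tangent:
  fixes s t q :: real
  assumes "0 \<le> q" "q \<le> 1" "0 \<le> s" "0 < t"
  shows "s powr q \<le> q * (s / t powr (1 - q)) + (1 - q) * t powr q"
proof -
  \<comment> \<open>Weighted AM-GM with weights q and 1 - q, for s > 0. If s = 0 the left side is 0,
    because \<open>0 powr q = 0\<close> even for q = 0. Dividing by \<open>t powr (1 - q)\<close>
    then gives the tangent line at t.\<close>
  have "s powr q * t powr (1 - q) \<le> q * s + (1 - q) * t"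
    using Youngs_inequality_0[of q "1 - q" s t] assms by (cases "s = 0") auto
  moreover have "t = t powr q * t powr (1 - q)"
    using assms by (simp flip: powr_add)
  ultimately have "s powr q * t powr (1 - q) \<le> q * s + (1 - q) * (t powr q * t powr (1 - q))"
    by simp
  then show ?thesis
    using assms by (simp add: field_simps)
qed

lemma square_powr:
  fixes M a :: real
  assumes "0 \<le> M"
  shows "M\<^sup>2 powr a = M powr (2 * a)"
  using assms by (cases "M = 0") (simp_all add: powr_powr flip: powr_numeral)

text \<open>The right side is the tangent to t^(p/2) at M^2, which settles s > eps^2 by concavity.
  For s <= eps^2, \<open>Psi\<close> is itself affine, namely the tangent at eps^2. The tangent at
  M^2 is above it at s = eps^2 and, since M >= eps, is no steeper, so it stays above to the
  left.\<close>

lemma Psi_le_quadratic: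
  assumes "0 < p" "p \<le> 2" "0 < \<epsilon>" "0 \<le> s" "\<epsilon> \<le> M"
  shows "Psi p \<epsilon> s \<le> p / 2 * (s / M powr (2 - p)) + (1 - p / 2) * M powr p"
proof -
  have tangent: "r powr (p / 2) \<le> p / 2 * (r / M powr (2 - p)) + (1 - p / 2) * M powr p"
    if "0 \<le> r" for r
    using powr_le_tangent[of "p / 2" r "M\<^sup>2"] that assms
    by (simp add: square_powr algebra_simps)
  show ?thesis
  proof (cases "s \<le> \<epsilon>\<^sup>2")
    case True
    have "\<epsilon> powr p = \<epsilon>\<^sup>2 / \<epsilon> powr (2 - p)"
      using assms by (simp add: powr_diff)
    then have "Psi p \<epsilon> s = \<epsilon> powr p + p / 2 * ((s - \<epsilon>\<^sup>2) / \<epsilon> powr (2 - p))"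
      using True by (simp add: Psi_def algebra_simps diff_divide_distrib)
    \<comment> \<open>The numerator is nonpositive, so the larger denominator increases the
      quotient.\<close>
    moreover have "(s - \<epsilon>\<^sup>2) / \<epsilon> powr (2 - p) \<le> (s - \<epsilon>\<^sup>2) / M powr (2 - p)"
      using True assms by (intro divide_left_mono_neg powr_mono2) auto
    then have "p / 2 * ((s - \<epsilon>\<^sup>2) / \<epsilon> powr (2 - p)) \<le> p / 2 * ((s - \<epsilon>\<^sup>2) / M powr (2 - p))"
      using assms by (intro mult_left_mono) auto
    moreover have "\<epsilon> powr p \<le> p / 2 * (\<epsilon>\<^sup>2 / M powr (2 - p)) + (1 - p / 2) * M powr p"
      using tangent[of "\<epsilon>\<^sup>2"] assms by (simp add: square_powr)
    ultimately show ?thesis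
      by (simp add: algebra_simps diff_divide_distrib)
  next
    case False
    then show ?thesis
      using tangent[of s] assms by (simp add: Psi_def)
  qed
qed

text \<open>If M = eps this is the affine branch of \<open>Psi\<close>. If M = |v| both summands are
  multiples of |v|^p, with coefficients adding up to 1.\<close>

lemma Psi_square_eq_quadratic:
  fixes v :: real
  assumes "0 < p" "p \<le> 2" "0 < \<epsilon>"
  defines "M \<equiv> max \<epsilon> \<bar>v\<bar>"
  shows "Psi p \<epsilon> (v\<^sup>2) = p / 2 * (v\<^sup>2 / M powr (2 - p)) + (1 - p / 2) * M powr p"
proof (cases "\<bar>v\<bar> \<le> \<epsilon>")
  case True
  then show ?thesis
    using abs_le_square_iff[of v \<epsilon>] assms by (simp add: Psi_def max_def)
next
  case False
  have "v\<^sup>2 / \<bar>v\<bar> powr (2 - p) = \<bar>v\<bar> powr p"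
    using False assms by (simp add: powr_diff)
  moreover have "v\<^sup>2 powr (p / 2) = \<bar>v\<bar> powr p"
    using square_powr[of "\<bar>v\<bar>" "p / 2"] by simp
  ultimately show ?thesis
    using abs_le_square_iff[of v \<epsilon>] False assms
    by (simp add: Psi_def max_def algebra_simps)
qed

lemma max_powr:
  fixes a b c :: real
  assumes "0 \<le> a" "0 \<le> b" "0 \<le> c"
  shows "max (a powr c) (b powr c) = max a b powr c"
proof (cases "a \<le> b")
  case True
  then show ?thesis using powr_mono2[of c a b] assms by (simp add: max_def)
next
  case False
  then have "b powr c \<le> a powr c" using powr_mono2[of c b a] assms by simp
  then show ?thesis using False by (simp add: max_def)
qed

text \<open>The majorant with M = max eps |v| bounds the value at u and is exact at v, so its
  constant term cancels in the difference. Multiplied by beta, the remaining slope is half a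
  diagonal entry of N.\<close>

lemma Psi_square_diff_le:
  assumes "0 < p" "p \<le> 2" "0 < \<epsilon>"
  shows "Psi p \<epsilon> (u\<^sup>2) - Psi p \<epsilon> (v\<^sup>2)
    \<le> p / 2 * ((u\<^sup>2 - v\<^sup>2) / max (\<epsilon> powr (2 - p)) (\<bar>v\<bar> powr (2 - p)))"
proof -
  define M where "M = max \<epsilon> \<bar>v\<bar>"
  have "max (\<epsilon> powr (2 - p)) (\<bar>v\<bar> powr (2 - p)) = M powr (2 - p)"
    using max_powr[of \<epsilon> "\<bar>v\<bar>" "2 - p"] assms by (simp add: M_def)
  moreover have "Psi p \<epsilon> (u\<^sup>2) \<le> p / 2 * (u\<^sup>2 / M powr (2 - p)) + (1 - p / 2) * M powr p"
    using Psi_le_quadratic[of p \<epsilon> "u\<^sup>2" M] assms by (simp add: M_def)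
  moreover note Psi_square_eq_quadratic[OF assms, of v, folded M_def]
  ultimately show ?thesis
    by (simp add: algebra_simps diff_divide_distrib)
qed

lemma Psi_nonneg:
  assumes "0 < p" "p \<le> 2" "0 < \<epsilon>" "0 \<le> t"
  shows "0 \<le> Psi p \<epsilon> t"
  using assms by (simp add: Psi_def)

text \<open>Coercivity of \<open>Psi\<close>: above eps it equals |v|^p, which can be
  inverted.\<close>

lemma abs_le_of_Psi_le:
  assumes "0 < p" "0 < \<epsilon>" "Psi p \<epsilon> (v\<^sup>2) \<le> c"
  shows "\<bar>v\<bar> \<le> max \<epsilon> (c powr (1 / p))"
proof (cases "\<bar>v\<bar> \<le> \<epsilon>")
  case False
  then have "\<bar>v\<bar> powr p \<le> c"
    using abs_le_square_iff[of v \<epsilon>] square_powr[of "\<bar>v\<bar>" "p / 2"] assms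
    by (simp add: Psi_def)
  then have "(\<bar>v\<bar> powr p) powr (1 / p) \<le> c powr (1 / p)"
    using assms by (intro powr_mono2) auto
  then show ?thesis
    using False assms by (simp add: powr_powr)
qed simp

section \<open>The diagonal entries of N as functions of one component\<close>

definition weight :: "real \<Rightarrow> real \<Rightarrow> real \<Rightarrow> real \<Rightarrow> real" where
  "weight \<beta> p \<epsilon> v = \<beta> * p / max (\<epsilon> powr (2 - p)) (\<bar>v\<bar> powr (2 - p))"

lemma weight_pos: "0 < \<beta> \<Longrightarrow> 0 < p \<Longrightarrow> 0 < \<epsilon> \<Longrightarrow> 0 < weight \<beta> p \<epsilon> v"
  by (simp add: weight_def less_max_iff_disj)

lemma weight_matrix_mult_nth: "(weight_matrix \<beta> p \<epsilon> y *v z) $ i = weight \<beta> p \<epsilon> (y $ i) * z $ i"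
  by (simp add: weight_matrix_def matrix_vector_mult_def weight_def if_distrib[of "\<lambda>a. a * _"]
      cong: if_cong)

text \<open>The denominator is at least eps^(2-p) > 0, and the positive exponent 2 - p keeps
  |v|^(2-p) continuous at 0.\<close>

lemma continuous_weight:
  assumes "p < 2" "0 < \<epsilon>"
  shows "isCont (weight \<beta> p \<epsilon>) v"
  unfolding weight_def
  using assms by (intro continuous_intros) (auto simp: max_def)

lemma tendsto_matrix_vector_mult:
  fixes B :: "real ^ 'a ^ 'b"
  shows "(f \<longlongrightarrow> l) F \<Longrightarrow> ((\<lambda>k. B *v f k) \<longlongrightarrow> B *v l) F"
  by (rule bounded_linear.tendsto[OF matrix_vector_mul_bounded_linear])

section \<open>Descent and coercivity of \<open>J\<close>\<close>

lemma J_nonneg: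
  assumes "0 < p" "p \<le> 2" "0 < \<epsilon>" "0 < \<beta>"
  shows "0 \<le> J A \<Lambda> b \<beta> p \<epsilon> x"
  unfolding J_def using assms
  by (auto intro!: add_nonneg_nonneg mult_nonneg_nonneg sum_nonneg Psi_nonneg)

text \<open>Pairing the equation for z with z - x makes the first-order terms cancel; the squares
  left over from the quadratic expansions are the gain.\<close>

lemma J_descent:
  fixes A :: "real ^ 'n ^ 'm" and \<Lambda> :: "real ^ 'n ^ 'r"
  assumes p: "0 < p" "p \<le> 2" and "0 < \<epsilon>" "0 < \<beta>"
    and step: "transpose A *v (A *v z)
               + transpose \<Lambda> *v (weight_matrix \<beta> p \<epsilon> (\<Lambda> *v x) *v (\<Lambda> *v z)) = transpose A *v b"
  shows "1 / 2 * (norm (A *v (z - x)))\<^sup>2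
      + 1 / 2 * (\<Sum>i\<in>UNIV. weight \<beta> p \<epsilon> ((\<Lambda> *v x) $ i) * ((\<Lambda> *v (z - x)) $ i)\<^sup>2)
    \<le> J A \<Lambda> b \<beta> p \<epsilon> x - J A \<Lambda> b \<beta> p \<epsilon> z"
proof -
  define d y u where "d = z - x" and "y = \<Lambda> *v x" and "u = \<Lambda> *v z"
  define w where "w i = weight \<beta> p \<epsilon> (y $ i)" for i
  have Ld: "\<Lambda> *v d = u - y" and Ad: "A *v d = A *v z - A *v x"
    by (simp_all add: d_def u_def y_def matrix_vector_mult_diff_distrib)
  have "(A *v z - b) \<bullet> (A *v d) + (weight_matrix \<beta> p \<epsilon> y *v u) \<bullet> (\<Lambda> *v d) = 0"
  proof -
    have "(transpose A *v (A *v z) + transpose \<Lambda> *v (weight_matrix \<beta> p \<epsilon> y *v u)) \<bullet> d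
        = (transpose A *v b) \<bullet> d"
      using step by (simp add: y_def u_def)
    then show ?thesis
      by (simp add: inner_add_left inner_diff_left dot_lmul_matrix)
  qed
  moreover have "(weight_matrix \<beta> p \<epsilon> y *v u) \<bullet> (\<Lambda> *v d) = (\<Sum>i\<in>UNIV. w i * u $ i * (u $ i - y $ i))"
    by (simp add: inner_vec_def weight_matrix_mult_nth w_def Ld)
  ultimately have stationary:
    "(A *v z - b) \<bullet> (A *v d) + (\<Sum>i\<in>UNIV. w i * u $ i * (u $ i - y $ i)) = 0" by simp
  \<comment> \<open>|P|^2 - |P - Q|^2 = 2 P.Q - |Q|^2 with P = A z - b and Q = A d.\<close>
  have fit: "(norm (A *v z - b))\<^sup>2 - (norm (A *v x - b))\<^sup>2
      = 2 * ((A *v z - b) \<bullet> (A *v d)) - (norm (A *v d))\<^sup>2"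
    by (simp add: Ad power2_norm_eq_inner algebra_simps inner_commute)
  \<comment> \<open>The identity u^2 - y^2 = 2 u (u - y) - (u - y)^2 separates the term that
    \<open>stationary\<close> cancels from the gain.\<close>
  have "\<beta> * (Psi p \<epsilon> ((u $ i)\<^sup>2) - Psi p \<epsilon> ((y $ i)\<^sup>2))
      \<le> w i * u $ i * (u $ i - y $ i) - 1 / 2 * (w i * (u $ i - y $ i)\<^sup>2)" for i
  proof -
    have "\<beta> * (Psi p \<epsilon> ((u $ i)\<^sup>2) - Psi p \<epsilon> ((y $ i)\<^sup>2)) \<le> 1 / 2 * (w i * ((u $ i)\<^sup>2 - (y $ i)\<^sup>2))"
      using mult_left_mono[OF Psi_square_diff_le[OF p \<open>0 < \<epsilon>\<close>, of "u $ i" "y $ i"], of \<beta>] \<open>0 < \<beta>\<close>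
      by (simp add: w_def weight_def mult_ac)
    then show ?thesis by (simp add: power2_eq_square algebra_simps)
  qed
  then have "\<beta> * (\<Sum>i\<in>UNIV. Psi p \<epsilon> ((u $ i)\<^sup>2)) - \<beta> * (\<Sum>i\<in>UNIV. Psi p \<epsilon> ((y $ i)\<^sup>2))
      \<le> (\<Sum>i\<in>UNIV. w i * u $ i * (u $ i - y $ i)) - 1 / 2 * (\<Sum>i\<in>UNIV. w i * (u $ i - y $ i)\<^sup>2)"
    unfolding sum_distrib_left sum_subtractf[symmetric] right_diff_distrib[symmetric]
    by (intro sum_mono) simp
  then have "1 / 2 * (norm (A *v d))\<^sup>2 + 1 / 2 * (\<Sum>i\<in>UNIV. w i * ((\<Lambda> *v d) $ i)\<^sup>2)
      \<le> J A \<Lambda> b \<beta> p \<epsilon> x - J A \<Lambda> b \<beta> p \<epsilon> z"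
    using stationary fit by (simp add: J_def u_def[symmetric] y_def[symmetric] Ld)
  then show ?thesis by (simp add: d_def w_def y_def)
qed

text \<open>The kernel condition makes x |-> (A x, Lambda x) injective, hence bounded below by a
  multiple of |x|, and a bound on \<open>J\<close> controls both components.\<close>

lemma J_sublevel_bounded:
  fixes A :: "real ^ 'n ^ 'm" and \<Lambda> :: "real ^ 'n ^ 'r"
  assumes p: "0 < p" "p \<le> 2" and "0 < \<epsilon>" "0 < \<beta>"
    and ker: "{v. A *v v = 0} \<inter> {v. \<Lambda> *v v = 0} = {0}"
  shows "bounded {x. J A \<Lambda> b \<beta> p \<epsilon> x \<le> c}"
proof -
  define f where "f x = (A *v x, \<Lambda> *v x)" for x
  have lin: "linear f"
    unfolding f_def
    by (intro linearI) (simp_all add: matrix_vector_right_distrib matrix_vector_mult_scaleR)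
  moreover have "inj f"
    unfolding linear_injective_0[OF lin] using ker by (auto simp: f_def zero_prod_def)
  ultimately obtain B where B: "0 < B" "\<And>x. B * norm x \<le> norm (f x)"
    using linear_inj_bounded_below_pos[of f] by blast
  \<comment> \<open>The first two terms bound |A x| through the data fit. The last bounds |Lambda x|
    by its l1 norm, each component being limited by \<open>Psi\<close> <= c / beta.\<close>
  define K where "K = norm b + sqrt (2 * c) + real CARD('r) * max \<epsilon> ((c / \<beta>) powr (1 / p))"
  have "norm x \<le> K / B" if le: "J A \<Lambda> b \<beta> p \<epsilon> x \<le> c" for x
  proof -
    have S: "0 \<le> Psi p \<epsilon> (((\<Lambda> *v x) $ i)\<^sup>2)" for i
      using assms by (intro Psi_nonneg) auto
    then have "0 \<le> \<beta> * (\<Sum>i\<in>UNIV. Psi p \<epsilon> (((\<Lambda> *v x) $ i)\<^sup>2))"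
      using \<open>0 < \<beta>\<close> by (intro mult_nonneg_nonneg sum_nonneg) auto
    then have "(norm (A *v x - b))\<^sup>2 \<le> 2 * c"
      and PsiS: "\<beta> * (\<Sum>i\<in>UNIV. Psi p \<epsilon> (((\<Lambda> *v x) $ i)\<^sup>2)) \<le> c"
      using le zero_le_power2[of "norm (A *v x - b)"] unfolding J_def power2_abs by linarith+
    then have "norm (A *v x - b) \<le> sqrt (2 * c)" by (simp add: real_le_rsqrt)
    then have nA: "norm (A *v x) \<le> norm b + sqrt (2 * c)"
      using norm_triangle_sub[of "A *v x" b] by simp
    have "\<bar>(\<Lambda> *v x) $ i\<bar> \<le> max \<epsilon> ((c / \<beta>) powr (1 / p))" for i
    proof (rule abs_le_of_Psi_le[OF \<open>0 < p\<close> \<open>0 < \<epsilon>\<close>])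
      have "Psi p \<epsilon> (((\<Lambda> *v x) $ i)\<^sup>2) \<le> (\<Sum>i\<in>UNIV. Psi p \<epsilon> (((\<Lambda> *v x) $ i)\<^sup>2))"
        using S by (intro member_le_sum) auto
      also have "\<dots> \<le> c / \<beta>" using PsiS \<open>0 < \<beta>\<close> by (simp add: field_simps)
      finally show "Psi p \<epsilon> (((\<Lambda> *v x) $ i)\<^sup>2) \<le> c / \<beta>" .
    qed
    then have "(\<Sum>i\<in>UNIV. \<bar>(\<Lambda> *v x) $ i\<bar>) \<le> real CARD('r) * max \<epsilon> ((c / \<beta>) powr (1 / p))"
      by (intro sum_bounded_above) auto
    then have nL: "norm (\<Lambda> *v x) \<le> real CARD('r) * max \<epsilon> ((c / \<beta>) powr (1 / p))"
      using norm_le_l1_cart[of "\<Lambda> *v x"] by simp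
    have "B * norm x \<le> norm (A *v x) + norm (\<Lambda> *v x)"
      using B(2)[of x] norm_Pair_le[of "A *v x" "\<Lambda> *v x"] by (simp add: f_def)
    then have "B * norm x \<le> K" using nA nL by (simp add: K_def)
    then show ?thesis using B(1) by (simp add: field_simps)
  qed
  then show ?thesis by (auto intro: boundedI)
qed

section \<open>Monotonicity, existence of cluster points, and passage to the limit\<close>

theorem theorem2p2:
  fixes A :: "real ^ 'n ^ 'm" and \<Lambda> :: "real ^ 'n ^ 'r" and b :: "real ^ 'm"
    and p \<beta> \<epsilon> :: real and x :: "nat \<Rightarrow> real ^ 'n"
  assumes "0 < p" and "p \<le> 1" and "\<beta> > 0" and "\<epsilon> > 0"
    and "{v. A *v v = 0} \<inter> {v. \<Lambda> *v v = 0} = {0}"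
    and "\<And>k. transpose A *v (A *v x (Suc k))
               + transpose \<Lambda> *v (weight_matrix \<beta> p \<epsilon> (\<Lambda> *v x k) *v (\<Lambda> *v x (Suc k)))
             = transpose A *v b"
  shows "(strict_antimono_on UNIV (\<lambda>k. J A \<Lambda> b \<beta> p \<epsilon> (x k)) \<or>
           (\<exists>k. x k = x (Suc k) \<and> optimality_eq A \<Lambda> b \<beta> p \<epsilon> (x k)))
       \<and> (\<exists>l. cluster_point x l)
       \<and> (\<forall>l. cluster_point x l \<longrightarrow> optimality_eq A \<Lambda> b \<beta> p \<epsilon> l)"
proof (intro conjI allI impI)
  let ?J = "\<lambda>k. J A \<Lambda> b \<beta> p \<epsilon> (x k)"
  define d where "d k = x (Suc k) - x k" for k
  define w where "w k i = weight \<beta> p \<epsilon> ((\<Lambda> *v x k) $ i)" for k i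
  have p2: "p \<le> 2" using \<open>p \<le> 1\<close> by simp
  have w_pos: "0 < w k i" for k i
    unfolding w_def using assms by (intro weight_pos)
  have descent: "1 / 2 * (norm (A *v d k))\<^sup>2 + 1 / 2 * (\<Sum>i\<in>UNIV. w k i * ((\<Lambda> *v d k) $ i)\<^sup>2)
      \<le> ?J k - ?J (Suc k)" for k
    unfolding d_def w_def using J_descent[OF \<open>0 < p\<close> p2 \<open>\<epsilon> > 0\<close> \<open>\<beta> > 0\<close> assms(6)] .
  have term_nonneg: "0 \<le> w k i * ((\<Lambda> *v d k) $ i)\<^sup>2" for k i
    using w_pos[of k i] by simp
  then have sum_nonneg': "0 \<le> (\<Sum>i\<in>UNIV. w k i * ((\<Lambda> *v d k) $ i)\<^sup>2)" for k
    by (intro sum_nonneg)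
  have A_le: "(norm (A *v d k))\<^sup>2 \<le> 2 * (?J k - ?J (Suc k))" for k
    using descent[of k] sum_nonneg'[of k] by argo
  have L_le: "w k i * ((\<Lambda> *v d k) $ i)\<^sup>2 \<le> 2 * (?J k - ?J (Suc k))" for k i
  proof -
    have "w k i * ((\<Lambda> *v d k) $ i)\<^sup>2 \<le> (\<Sum>i\<in>UNIV. w k i * ((\<Lambda> *v d k) $ i)\<^sup>2)"
      using term_nonneg by (intro member_le_sum) auto
    then show ?thesis using descent[of k] zero_le_power2[of "norm (A *v d k)"] by argo
  qed
  have antimono: "?J (Suc k) \<le> ?J k" for k
    using A_le[of k] zero_le_power2[of "norm (A *v d k)"] by argo
  then have dec: "decseq ?J" by (rule decseq_SucI)

  show "strict_antimono_on UNIV ?J \<or> (\<exists>k. x k = x (Suc k) \<and> optimality_eq A \<Lambda> b \<beta> p \<epsilon> (x k))"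
  proof (cases "\<exists>k. x k = x (Suc k)")
    case True
    \<comment> \<open>With x k = x (k+1) the iteration equation at k is the optimality equation
      itself.\<close>
    then show ?thesis using assms(6) by (metis optimality_eq_def)
  next
    case False
    have "?J (Suc k) < ?J k" for k
    \<comment> \<open>Without a decrease, A d and, as the weights are positive, Lambda d vanish; the
      kernel condition forces d = 0.\<close>
    proof (rule ccontr)
      assume "\<not> ?J (Suc k) < ?J k"
      then have 0: "2 * (?J k - ?J (Suc k)) = 0" using antimono[of k] by simp
      have "A *v d k = 0" using A_le[of k] unfolding 0 by simp
      moreover have "(\<Lambda> *v d k) $ i = 0" for i
        using L_le[of k i] w_pos[of k i] unfolding 0 by (simp add: mult_le_0_iff)
      then have "\<Lambda> *v d k = 0" by (simp add: vec_eq_iff)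
      ultimately have "d k = 0" using assms(5) by blast
      then show False using False by (metis d_def eq_iff_diff_eq_0)
    qed
    then have "strict_antimono_on UNIV ?J"
      by (intro monotone_onI) (metis lift_Suc_mono_less[of "\<lambda>k. - ?J k"] neg_less_iff_less)
    then show ?thesis ..
  qed

  show "\<exists>l. cluster_point x l"
  proof -
    have "range x \<subseteq> {z. J A \<Lambda> b \<beta> p \<epsilon> z \<le> ?J 0}"
      using dec by (auto simp: decseq_def)
    then have "bounded (range x)"
      using J_sublevel_bounded[OF \<open>0 < p\<close> p2 \<open>\<epsilon> > 0\<close> \<open>\<beta> > 0\<close> assms(5)] bounded_subset by blast
    then show ?thesis
      using bounded_imp_convergent_subsequence[of x] by (auto simp: cluster_point_def)
  qed

  fix l assume "cluster_point x l"
  then obtain s where s: "strict_mono s" and lim: "(\<lambda>k. x (s k)) \<longlonglongrightarrow> l"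
    by (auto simp: cluster_point_def o_def)
  have "\<forall>k. 0 \<le> ?J k"
    using assms p2 by (intro allI J_nonneg)
  from decseq_convergent[OF dec this] obtain c where c: "?J \<longlonglongrightarrow> c"
    by metis
  \<comment> \<open>Consecutive values of the convergent sequence \<open>?J\<close> have differences
    tending to 0, so the same holds along s.\<close>
  have "(\<lambda>k. 2 * (?J k - ?J (Suc k))) \<longlonglongrightarrow> 2 * (c - c)"
    using c LIMSEQ_Suc[OF c] by (intro tendsto_intros)
  from LIMSEQ_subseq_LIMSEQ[OF this s]
  have gap: "(\<lambda>k. 2 * (?J (s k) - ?J (Suc (s k)))) \<longlonglongrightarrow> 0" by (simp add: o_def)
  have "(\<lambda>k. (norm (A *v d (s k)))\<^sup>2) \<longlonglongrightarrow> 0"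
    by (rule tendsto_sandwich[OF _ _ tendsto_const gap]) (use A_le in auto)
  then have "(\<lambda>k. A *v d (s k)) \<longlonglongrightarrow> 0"
    by (simp add: tendsto_norm_zero_iff)
  from tendsto_add[OF tendsto_matrix_vector_mult[OF lim, of A] this]
  have A_lim: "(\<lambda>k. A *v x (Suc (s k))) \<longlonglongrightarrow> A *v l"
    by (simp add: d_def matrix_vector_mult_diff_distrib)
  have y_lim: "(\<lambda>k. (\<Lambda> *v x (s k)) $ i) \<longlonglongrightarrow> (\<Lambda> *v l) $ i" for i
    by (intro tendsto_vec_nth tendsto_matrix_vector_mult lim)
  have w_lim: "(\<lambda>k. w (s k) i) \<longlonglongrightarrow> weight \<beta> p \<epsilon> ((\<Lambda> *v l) $ i)" for i
    unfolding w_def using assms by (intro isCont_tendsto_compose[OF continuous_weight] y_lim) auto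
  have u_lim: "(\<lambda>k. (\<Lambda> *v x (Suc (s k))) $ i) \<longlonglongrightarrow> (\<Lambda> *v l) $ i" for i
  proof -
    have wl: "weight \<beta> p \<epsilon> ((\<Lambda> *v l) $ i) \<noteq> 0"
      using weight_pos[of \<beta> p \<epsilon> "(\<Lambda> *v l) $ i"] assms by simp
    have "(\<lambda>k. w (s k) i * ((\<Lambda> *v d (s k)) $ i)\<^sup>2) \<longlonglongrightarrow> 0"
      by (rule tendsto_sandwich[OF _ _ tendsto_const gap]) (use L_le term_nonneg in auto)
    \<comment> \<open>The weights have a nonzero limit, so they can be divided out of the vanishing
      weighted squares.\<close>
    from tendsto_divide[OF this w_lim[of i] wl]
    have "(\<lambda>k. ((\<Lambda> *v d (s k)) $ i)\<^sup>2) \<longlonglongrightarrow> 0"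
      using w_pos by (simp add: less_imp_neq[symmetric])
    then have "(\<lambda>k. (\<Lambda> *v d (s k)) $ i) \<longlonglongrightarrow> 0" by simp
    from tendsto_add[OF y_lim[of i] this] show ?thesis
      by (simp add: d_def matrix_vector_mult_diff_distrib)
  qed
  have "(\<lambda>k. weight_matrix \<beta> p \<epsilon> (\<Lambda> *v x (s k)) *v (\<Lambda> *v x (Suc (s k))))
      \<longlonglongrightarrow> weight_matrix \<beta> p \<epsilon> (\<Lambda> *v l) *v (\<Lambda> *v l)"
  proof (rule vec_tendstoI)
    fix i
    show "(\<lambda>k. (weight_matrix \<beta> p \<epsilon> (\<Lambda> *v x (s k)) *v (\<Lambda> *v x (Suc (s k)))) $ i)
      \<longlonglongrightarrow> (weight_matrix \<beta> p \<epsilon> (\<Lambda> *v l) *v (\<Lambda> *v l)) $ i"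
      unfolding weight_matrix_mult_nth using tendsto_mult[OF w_lim u_lim] by (simp add: w_def)
  qed
  from tendsto_add[OF tendsto_matrix_vector_mult[OF A_lim, of "transpose A"]
      tendsto_matrix_vector_mult[OF this, of "transpose \<Lambda>"]]
  \<comment> \<open>By the iteration equation the left side is constant along s, so it equals the
    limit of the right side.\<close>
  have "(\<lambda>k. transpose A *v b) \<longlonglongrightarrow> transpose A *v (A *v l)
      + transpose \<Lambda> *v (weight_matrix \<beta> p \<epsilon> (\<Lambda> *v l) *v (\<Lambda> *v l))"
    unfolding assms(6) .
  then show "optimality_eq A \<Lambda> b \<beta> p \<epsilon> l"
    unfolding optimality_eq_def by (simp add: LIMSEQ_const_iff)
qed

end
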